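(* For online matching on the line with predictions, the algorithm Follow-The-Prediction (described below) has total matching cost at most $\textsc{Off}+2\eta$, and hence competitive ratio $1+2\eta/\textsc{Off}$, against any offline algorithm $\textsc{Off}$, where $\eta$ is the prediction error with respect to $\textsc{Off}$ and $\textsc{Off}$ also denotes its cost.
   Context: Online matching on the line: servers $S=\{s_1,\dots,s_n\}\subset\mathbb{R}$; requests $r_1,\dots,r_n\in\mathbb{R}$ arrive online, each must be irrevocably matched to a previously unmatched server at cost equal to their distance; the objective is the total cost. The configuration after $i$ requests is the set of matched servers. For sets (or multisets) $X,Y$ of equal size, $\mathit{dist}(X,Y)$ is the cost of a minimum-cost perfect matching between them. In round $i$ the algorithm also receives a predicted configuration $P_i\subseteq S$, $|P_i|=i$. For an offline algorithm with configurations $\textsc{Off}_i$, the error is $\eta=\sum_{i=1}^n\mathit{dist}(P_i,\textsc{Off}_i)$. Follow-The-Prediction: let $S_i$ be its configuration after round $i$ ($S_0=P_0=\emptyset$). Let $\mu_i$ be a minimum-cost perfect matching between $S_i$ and $P_i$ in which every server of $S_i\cap P_i$ is matched to itself, extended to all of $S$ by $\mu_i(q)=q$ for $q\notin S_i\cup P_i$. When $r_{i+1}$ and $P_{i+1}$ arrive, compute an optimal matching between $P_{i+1}$ and the multiset $P_i\cup\{r_{i+1}\}$ that maps each element of $P_{i+1}\cap P_i$ to itself; it matches $r_{i+1}$ to some server $s\in P_{i+1}\setminus P_i$. The algorithm matches $r_{i+1}$ to the server $\mu_i(s)$ (which is unmatched). *)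

theory Defs
  imports Complex_Main "HOL-Library.Multiset"
begin

section \<open>Minimum-cost perfect matchings between multisets of points on the line\<close>

text \<open>A perfect matching between two finite multisets is the multiset of its matched pairs.\<close>

definition perfect_matchings :: "real multiset \<Rightarrow> real multiset \<Rightarrow> (real \<times> real) multiset set" where
  "perfect_matchings X Y = {M. image_mset fst M = X \<and> image_mset snd M = Y}"

definition matching_cost :: "(real \<times> real) multiset \<Rightarrow> real" where
  "matching_cost M = (\<Sum>(x, y)\<in>#M. \<bar>x - y\<bar>)"

text \<open>
  For multisets of equal size the set of perfect matchings is finite and nonempty, so that the
  minimum exists; for different sizes the value is unspecified.
\<close>

definition mdist :: "real multiset \<Rightarrow> real multiset \<Rightarrow> real" where
  "mdist X Y = Min (matching_cost ` perfect_matchings X Y)"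

definition min_cost_matching ::
    "real multiset \<Rightarrow> real multiset \<Rightarrow> (real \<times> real) multiset \<Rightarrow> bool" where
  "min_cost_matching X Y M \<longleftrightarrow> M \<in> perfect_matchings X Y \<and> matching_cost M = mdist X Y"

section \<open>Matching requests to servers\<close>

text \<open>
  An assignment a sends the i-th request, for i in {1..n}, to the server a i.
  Indices outside {1..n} are irrelevant.
\<close>

definition valid_assignment :: "real set \<Rightarrow> nat \<Rightarrow> (nat \<Rightarrow> real) \<Rightarrow> bool" where
  "valid_assignment S n a \<longleftrightarrow> bij_betw a {1..n} S"

definition config :: "(nat \<Rightarrow> real) \<Rightarrow> nat \<Rightarrow> real set" where
  "config a i = a ` {1..i}"

definition total_cost :: "nat \<Rightarrow> (nat \<Rightarrow> real) \<Rightarrow> (nat \<Rightarrow> real) \<Rightarrow> real" where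
  "total_cost n r a = (\<Sum>i=1..n. \<bar>r i - a i\<bar>)"

definition prediction_error :: "nat \<Rightarrow> (nat \<Rightarrow> real set) \<Rightarrow> (nat \<Rightarrow> real) \<Rightarrow> real" where
  "prediction_error n P off = (\<Sum>i=1..n. mdist (mset_set (P i)) (mset_set (config off i)))"

section \<open>Follow-The-Prediction\<close>

text \<open>
  \<open>config_matching C P \<mu>\<close>: the map \<open>\<mu>\<close> sends each point of C or P to its partner in a
  minimum-cost perfect matching between C and P that matches common points to themselves, and fixes
  all other points. Since a matching is undirected, \<open>\<mu>\<close> is an involution; this determines it on
  P - C.
\<close>

definition config_matching :: "real set \<Rightarrow> real set \<Rightarrow> (real \<Rightarrow> real) \<Rightarrow> bool" where
  "config_matching C P \<mu> \<longleftrightarrow>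
     min_cost_matching (mset_set C) (mset_set P) (image_mset (\<lambda>q. (q, \<mu> q)) (mset_set C)) \<and>
     (\<forall>q\<in>C \<inter> P. \<mu> q = q) \<and>
     (\<forall>q. q \<notin> C \<union> P \<longrightarrow> \<mu> q = q) \<and>
     (\<forall>q. \<mu> (\<mu> q) = q)"

text \<open>
  One round: C is the current configuration, P and P' are the previous and the new prediction, x is
  the new request and t the server it is matched to. If x coincides with a point of P, the
  requirement that s is not in P selects a partner of the request rather than of that point when
  the point is matched to itself. All tie-breaking choices are allowed.
\<close>

definition ftp_step ::
    "real set \<Rightarrow> real set \<Rightarrow> real set \<Rightarrow> real \<Rightarrow> real \<Rightarrow> bool" where
  "ftp_step C P P' x t \<longleftrightarrow>
     (\<exists>\<mu> M s. config_matching C P \<mu> \<and>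
        min_cost_matching (mset_set P') (add_mset x (mset_set P)) M \<and>
        (\<forall>p\<in>P' \<inter> P. (p, p) \<in># M) \<and>
        s \<in> P' - P \<and> (s, x) \<in># M \<and>
        t = \<mu> s)"

definition ftp_run :: "nat \<Rightarrow> (nat \<Rightarrow> real) \<Rightarrow> (nat \<Rightarrow> real set) \<Rightarrow> (nat \<Rightarrow> real) \<Rightarrow> bool" where
  "ftp_run n r P a \<longleftrightarrow>
     (\<forall>i<n. ftp_step (config a i) (P i) (P (Suc i)) (r (Suc i)) (a (Suc i)))"

end

theory Submission
  imports Defs
begin

text \<open>
  The potential is the distance between the configuration of the algorithm and the current
  prediction. Moving the new request first to the server s that the prediction buys and then along
  the matching to t, a round costs at most the distance between the new prediction and the old one
  together with the request, minus the increase of the potential: the pair (s, t) leaves the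
  matching and pays for the second part of the detour. By the triangle inequality through the
  offline configurations, that distance is at most the offline cost of the round plus the prediction
  errors before and after it, so every error is charged at most twice.
\<close>

section \<open>Minimum-cost matchings\<close>

lemma matching_cost_empty [simp]: "matching_cost {#} = 0"
  by (simp add: matching_cost_def)

lemma matching_cost_add [simp]:
  "matching_cost (add_mset p M) = \<bar>fst p - snd p\<bar> + matching_cost M"
  by (cases p) (simp add: matching_cost_def)

lemma matching_cost_union [simp]:
  "matching_cost (M + N) = matching_cost M + matching_cost N"
  by (induction M) auto

lemma matching_cost_nonneg: "0 \<le> matching_cost M"
  by (induction M) auto

lemma matching_cost_diag [simp]: "matching_cost (image_mset (\<lambda>q. (q, q)) Z) = 0"
  by (induction Z) auto

lemma perfect_matchings_add_iff [simp]:
  "add_mset (x, y) M \<in> perfect_matchings (add_mset x X) (add_mset y Y) \<longleftrightarrow>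
    M \<in> perfect_matchings X Y"
  by (simp add: perfect_matchings_def)

lemma size_eq_of_perfect_matching:
  "M \<in> perfect_matchings X Y \<Longrightarrow> size X = size Y"
  by (auto simp: perfect_matchings_def)

text \<open>Every matching is the multiset of some list of \<open>size X\<close> pairs from a finite
  product, and there are only finitely many such lists. This makes the \<open>Min\<close> in
  \<open>mdist\<close> meaningful.\<close>

lemma finite_perfect_matchings: "finite (perfect_matchings X Y)"
proof -
  have "perfect_matchings X Y \<subseteq>
      mset ` {ps. set ps \<subseteq> set_mset X \<times> set_mset Y \<and> length ps = size X}"
  proof
    fix M assume M: "M \<in> perfect_matchings X Y"
    obtain ps where ps: "mset ps = M"
      using ex_mset by blast
    have "set ps \<subseteq> set_mset X \<times> set_mset Y"
      using M ps by (force simp: perfect_matchings_def simp flip: set_mset_mset)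
    moreover have "length ps = size X"
      using M ps by (auto simp: perfect_matchings_def)
    ultimately show "M \<in> mset ` {ps. set ps \<subseteq> set_mset X \<times> set_mset Y \<and> length ps = size X}"
      using ps by blast
  qed
  then show ?thesis
    by (rule finite_subset) (intro finite_imageI finite_lists_length_eq, simp)
qed

lemma perfect_matchings_nonempty:
  assumes "size X = size Y"
  shows "perfect_matchings X Y \<noteq> {}"
  using assms
proof (induction X arbitrary: Y)
  case empty
  then show ?case by (auto simp: perfect_matchings_def)
next
  case (add x X)
  then obtain y Y' where Y: "Y = add_mset y Y'"
    by (metis size_eq_Suc_imp_eq_union size_add_mset)
  with add obtain M where "M \<in> perfect_matchings X Y'" by fastforce
  then show ?case using Y by (metis perfect_matchings_add_iff empty_iff)
qed

lemma mdist_le: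
  "M \<in> perfect_matchings X Y \<Longrightarrow> mdist X Y \<le> matching_cost M"
  unfolding mdist_def by (intro Min_le finite_imageI finite_perfect_matchings imageI)

lemma min_cost_matching_exists:
  assumes "size X = size Y"
  obtains M where "min_cost_matching X Y M"
proof -
  have "mdist X Y \<in> matching_cost ` perfect_matchings X Y"
    unfolding mdist_def
    by (intro Min_in) (simp_all add: finite_perfect_matchings perfect_matchings_nonempty assms)
  then show thesis using that by (auto simp: min_cost_matching_def)
qed

lemma min_cost_matchingI:
  assumes "M \<in> perfect_matchings X Y"
    and "\<And>N. N \<in> perfect_matchings X Y \<Longrightarrow> matching_cost M \<le> matching_cost N"
  shows "min_cost_matching X Y M"
proof -
  obtain N where "min_cost_matching X Y N"
    using min_cost_matching_exists size_eq_of_perfect_matching assms(1) by metis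
  then show ?thesis
    using assms mdist_le[OF assms(1)] by (force simp: min_cost_matching_def)
qed

lemma mdist_nonneg: "size X = size Y \<Longrightarrow> 0 \<le> mdist X Y"
  by (metis min_cost_matching_exists min_cost_matching_def matching_cost_nonneg)

lemma mdist_empty [simp]: "mdist {#} {#} = 0"
  using mdist_le[of "{#}" "{#}" "{#}"] mdist_nonneg[of "{#}" "{#}"]
  by (simp add: perfect_matchings_def)

lemma mdist_add_le:
  assumes "size X = size Y"
  shows "mdist (add_mset x X) (add_mset y Y) \<le> \<bar>x - y\<bar> + mdist X Y"
proof -
  obtain M where M: "min_cost_matching X Y M"
    using min_cost_matching_exists assms by blast
  then show ?thesis
    using mdist_le[of "add_mset (x, y) M" "add_mset x X" "add_mset y Y"] by (simp add: min_cost_matching_def)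
qed

section \<open>Symmetry and the triangle inequality\<close>

lemma mdist_commute_le:
  assumes "size X = size Y"
  shows "mdist Y X \<le> mdist X Y"
proof -
  obtain M where M: "min_cost_matching X Y M"
    using min_cost_matching_exists assms by blast
  have "matching_cost (image_mset prod.swap M) = matching_cost M"
    by (induction M) auto
  moreover have "image_mset prod.swap M \<in> perfect_matchings Y X"
    using M by (auto simp: min_cost_matching_def perfect_matchings_def multiset.map_comp comp_def)
  ultimately show ?thesis
    using M mdist_le by (metis min_cost_matching_def)
qed

lemma mdist_commute: "size X = size Y \<Longrightarrow> mdist X Y = mdist Y X"
  by (simp add: mdist_commute_le order_antisym)

text \<open>The induction removes one pair \<open>(x, y)\<close> from \<open>M\<close> and some pair
  \<open>(y, z)\<close> from \<open>N\<close> and glues them to \<open>(x, z)\<close>, whose cost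
  the triangle inequality bounds. If \<open>y\<close> occurs several times, any of its partners in
  \<open>N\<close> will do.\<close>

lemma perfect_matchings_compose:
  assumes "M \<in> perfect_matchings X Y" "N \<in> perfect_matchings Y Z"
  obtains K where "K \<in> perfect_matchings X Z" "matching_cost K \<le> matching_cost M + matching_cost N"
proof -
  have "\<exists>K\<in>perfect_matchings X Z. matching_cost K \<le> matching_cost M + matching_cost N"
    using assms
  proof (induction M arbitrary: X Y Z N)
    case empty
    then show ?case by (auto simp: perfect_matchings_def)
  next
    case (add p M)
    obtain x y where p: "p = (x, y)" by force
    define X' Y' where "X' = image_mset fst M" and "Y' = image_mset snd M"
    have XY: "X = add_mset x X'" "Y = add_mset y Y'"
      using add.prems by (auto simp: perfect_matchings_def p X'_def Y'_def)
    then have "y \<in># image_mset fst N"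
      using add.prems by (simp add: perfect_matchings_def)
    then obtain z N' where N: "N = add_mset (y, z) N'"
      by (auto dest!: multi_member_split)
    define Z' where "Z' = image_mset snd N'"
    have Z: "Z = add_mset z Z'" and N': "N' \<in> perfect_matchings Y' Z'"
      using add.prems XY by (auto simp: perfect_matchings_def N Z'_def)
    have "M \<in> perfect_matchings X' Y'"
      by (simp add: perfect_matchings_def X'_def Y'_def)
    then obtain K where "K \<in> perfect_matchings X' Z'"
        "matching_cost K \<le> matching_cost M + matching_cost N'"
      using add.IH N' by blast
    then show ?case
      by (intro bexI[of _ "add_mset (x, z) K"]) (auto simp: p N XY Z)
  qed
  then show thesis using that by blast
qed

lemma mdist_triangle:
  assumes "size X = size Y" "size Y = size Z"
  shows "mdist X Z \<le> mdist X Y + mdist Y Z"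
proof -
  obtain M N where MN: "min_cost_matching X Y M" "min_cost_matching Y Z N"
    using min_cost_matching_exists assms by metis
  then obtain K where "K \<in> perfect_matchings X Z"
      "matching_cost K \<le> matching_cost M + matching_cost N"
    by (auto simp: min_cost_matching_def elim: perfect_matchings_compose)
  then show ?thesis
    using MN mdist_le[of K X Z] by (simp add: min_cost_matching_def)
qed

section \<open>Optimal matchings that fix common points\<close>

text \<open>If \<open>z\<close> is not matched to itself, the pairs \<open>(z, y)\<close> and
  \<open>(x, z)\<close> are short-circuited to \<open>(x, y)\<close>, which costs no more by the
  triangle inequality through \<open>z\<close>.\<close>

lemma perfect_matchings_cancel:
  assumes "M \<in> perfect_matchings (add_mset z X) (add_mset z Y)"
  obtains K where "K \<in> perfect_matchings X Y" "matching_cost K \<le> matching_cost M"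
proof (cases "(z, z) \<in># M")
  case True
  then obtain K where "M = add_mset (z, z) K"
    by (auto dest!: multi_member_split)
  then show ?thesis using assms that by auto
next
  case False
  have fst: "image_mset fst M = add_mset z X" and snd: "image_mset snd M = add_mset z Y"
    using assms by (auto simp: perfect_matchings_def)
  have "z \<in># image_mset fst M" by (simp add: fst)
  then obtain y M1 where M1: "M = add_mset (z, y) M1"
    by (auto dest!: multi_member_split)
  have "z \<in># image_mset snd M" by (simp add: snd)
  then obtain x where "(x, z) \<in># M" by auto
  \<comment> \<open>The two pairs through \<open>z\<close> are distinct because
    \<open>(z, z)\<close> is absent, so the second one survives the removal of the first.\<close>
  with False M1 have "(x, z) \<in># M1" by auto
  then obtain M2 where M2: "M1 = add_mset (x, z) M2"
    by (auto dest!: multi_member_split)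
  have "add_mset (x, y) M2 \<in> perfect_matchings X Y"
    using fst snd by (auto simp: perfect_matchings_def M1 M2 add_mset_commute)
  moreover have "matching_cost (add_mset (x, y) M2) \<le> matching_cost M"
    by (simp add: M1 M2)
  ultimately show ?thesis by (rule that)
qed

text \<open>The diagonal is free, and cancelling the points of \<open>Z\<close> one by one turns any
  competitor into a matching of \<open>X\<close> and \<open>Y\<close> that is no more
  expensive.\<close>

lemma min_cost_matching_add_diag:
  assumes "min_cost_matching X Y K"
  shows "min_cost_matching (Z + X) (Z + Y) (image_mset (\<lambda>q. (q, q)) Z + K)"
proof (rule min_cost_matchingI)
  show "image_mset (\<lambda>q. (q, q)) Z + K \<in> perfect_matchings (Z + X) (Z + Y)"
    using assms
    by (simp add: min_cost_matching_def perfect_matchings_def multiset.map_comp comp_def)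
next
  fix N assume "N \<in> perfect_matchings (Z + X) (Z + Y)"
  then have "\<exists>L\<in>perfect_matchings X Y. matching_cost L \<le> matching_cost N"
  proof (induction Z arbitrary: N)
    case empty
    then show ?case by auto
  next
    case (add z Z)
    then obtain L where "L \<in> perfect_matchings (Z + X) (Z + Y)" "matching_cost L \<le> matching_cost N"
      by (auto elim: perfect_matchings_cancel)
    with add.IH[of L] show ?case by (meson order_trans)
  qed
  then obtain L where "L \<in> perfect_matchings X Y" "matching_cost L \<le> matching_cost N"
    by blast
  then show "matching_cost (image_mset (\<lambda>q. (q, q)) Z + K) \<le> matching_cost N"
    using assms mdist_le[of L X Y] by (simp add: min_cost_matching_def)
qed

text \<open>Serves both matchings of a round: \<open>W\<close> is empty for the configuration
  against the prediction, and the single request for the new prediction against the old one. The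
  remainder \<open>K\<close> is kept explicit because partners must later be found outside the
  common points.\<close>

lemma min_cost_matching_fixing_common_points:
  assumes fin: "finite A" "finite B" and size: "card A = card B + size W"
  obtains M K where "min_cost_matching (mset_set A) (mset_set B + W) M"
    "M = image_mset (\<lambda>q. (q, q)) (mset_set (A \<inter> B)) + K"
    "image_mset fst K = mset_set (A - B)" "image_mset snd K = mset_set (B - A) + W"
proof -
  have A: "mset_set A = mset_set (A \<inter> B) + mset_set (A - B)"
    using fin by (subst mset_set_Union[symmetric]) (auto simp: Int_Diff_Un)
  have B: "mset_set B = mset_set (A \<inter> B) + mset_set (B - A)"
    using fin by (subst mset_set_Union[symmetric]) (auto intro: arg_cong[of _ _ mset_set])
  have "size (mset_set A) = size (mset_set B + W)" using size by simp
  then have "size (mset_set (A - B)) = size (mset_set (B - A) + W)"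
    unfolding A B by (simp del: size_mset_set)
  then obtain K where K: "min_cost_matching (mset_set (A - B)) (mset_set (B - A) + W) K"
    using min_cost_matching_exists by blast
  show thesis
  proof
    show "min_cost_matching (mset_set A) (mset_set B + W)
        (image_mset (\<lambda>q. (q, q)) (mset_set (A \<inter> B)) + K)"
      using min_cost_matching_add_diag[OF K, of "mset_set (A \<inter> B)"] by (simp add: A B add.assoc)
  qed (use K in \<open>auto simp: min_cost_matching_def perfect_matchings_def\<close>)
qed

section \<open>Existence of a round\<close>

text \<open>Points of a set have multiplicity one, so two pairs with the same first component and
  different second ones would give that point a count of at least two.\<close>

lemma matching_graph:
  assumes "finite A" "image_mset fst M = mset_set A"
  obtains f where "M = image_mset (\<lambda>q. (q, f q)) (mset_set A)"
proof -
  define f where "f q = (THE y. (q, y) \<in># M)" for q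
  have "y = y'" if yy: "(q, y) \<in># M" "(q, y') \<in># M" for q y y'
  proof (rule ccontr)
    assume "y \<noteq> y'"
    with yy obtain M' where "M = add_mset (q, y) (add_mset (q, y') M')"
      by (metis insert_DiffM insert_noteq_member old.prod.inject)
    then have "count (mset_set A) q \<ge> 2"
      using assms(2)[symmetric] by simp
    then show False
      using assms(1) by (cases "q \<in> A") auto
  qed
  then have f: "snd p = f (fst p)" if "p \<in># M" for p
    using that unfolding f_def by (intro the_equality[symmetric]) (cases p; auto)+
  have "M = image_mset (\<lambda>p. (fst p, f (fst p))) M"
    using f by (subst (1) multiset.map_ident[symmetric], intro image_mset_cong) (metis prod.collapse)
  also have "\<dots> = image_mset (\<lambda>q. (q, f q)) (image_mset fst M)"
    by (simp add: multiset.map_comp comp_def)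
  finally show thesis using that assms(2) by metis
qed

lemma bij_betw_of_image_mset_set:
  assumes "finite A" "finite B" "image_mset f (mset_set A) = mset_set B"
  shows "bij_betw f A B"
proof -
  have "f ` A = B"
    using arg_cong[OF assms(3), of set_mset] assms(1,2) by simp
  moreover have "card A = card B"
    using arg_cong[OF assms(3), of size] by simp
  ultimately show ?thesis
    using assms(1) by (auto simp: bij_betw_def intro: eq_card_imp_inj_on)
qed

text \<open>The optimal matching is the diagonal on \<open>C \<inter> P\<close> plus the graph of a
  bijection \<open>f\<close> from \<open>C - P\<close> to \<open>P - C\<close>. These two sets are
  disjoint, so \<open>f\<close> on the first, its inverse on the second and the identity elsewhere
  form an involution.\<close>

lemma config_matching_exists:
  assumes fin: "finite C" "finite P" and "card C = card P"
  obtains \<mu> where "config_matching C P \<mu>"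
proof -
  obtain M K where M: "min_cost_matching (mset_set C) (mset_set P) M"
    "M = image_mset (\<lambda>q. (q, q)) (mset_set (C \<inter> P)) + K"
    and K: "image_mset fst K = mset_set (C - P)" "image_mset snd K = mset_set (P - C) + {#}"
    using min_cost_matching_fixing_common_points[OF fin, of "{#}"] assms(3) by auto
  obtain f where f: "K = image_mset (\<lambda>q. (q, f q)) (mset_set (C - P))"
    using matching_graph[OF _ K(1)] fin by auto
  have bij: "bij_betw f (C - P) (P - C)"
    using K(2) fin by (intro bij_betw_of_image_mset_set) (auto simp: f multiset.map_comp comp_def)
  define g where "g = the_inv_into (C - P) f"
  define \<mu> where "\<mu> q = (if q \<in> C - P then f q else if q \<in> P - C then g q else q)" for q
  have g: "f (g q) = q" "g q \<in> C - P" if "q \<in> P - C" for q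
    using that bij f_the_inv_into_f[of f "C - P" q] the_inv_into_into[of f "C - P" q "C - P"]
    by (auto simp: g_def bij_betw_def)
  have f': "g (f q) = q" "f q \<in> P - C" if "q \<in> C - P" for q
    using that bij by (auto simp: g_def bij_betw_def the_inv_into_f_f)
  have inv: "\<mu> (\<mu> q) = q" for q
    using g[of q] f'[of q] by (auto simp: \<mu>_def)
  have C: "mset_set C = mset_set (C \<inter> P) + mset_set (C - P)"
    using fin by (subst mset_set_Union[symmetric]) (auto simp: Int_Diff_Un)
  have "image_mset (\<lambda>q. (q, \<mu> q)) (mset_set C) = M"
    unfolding C M(2) f image_mset_union using fin
    by (intro arg_cong2[of _ _ _ _ "(+)"] image_mset_cong) (auto simp: \<mu>_def)
  then show thesis
    using M(1) inv by (intro that[of \<mu>]) (auto simp: config_matching_def \<mu>_def)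
qed

lemma ftp_step_exists:
  assumes "finite C" "finite P" "finite P'" "card C = card P" "card P' = Suc (card P)"
  obtains t where "ftp_step C P P' x t"
proof -
  obtain \<mu> where \<mu>: "config_matching C P \<mu>"
    using config_matching_exists assms by blast
  obtain M K where M: "min_cost_matching (mset_set P') (add_mset x (mset_set P)) M"
    "M = image_mset (\<lambda>q. (q, q)) (mset_set (P' \<inter> P)) + K"
    and K: "image_mset fst K = mset_set (P' - P)" "image_mset snd K = mset_set (P - P') + {#x#}"
    using min_cost_matching_fixing_common_points[OF assms(3,2), of "{#x#}"] assms(5) by auto
  \<comment> \<open>The partner of the request is sought in \<open>K\<close> rather than in
    \<open>M\<close>: this forces it into \<open>P' - P\<close> even when \<open>x\<close> is itself
    a point of \<open>P\<close>.\<close>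
  have "x \<in># image_mset snd K" by (simp add: K)
  then obtain s where s: "(s, x) \<in># K" by auto
  then have "s \<in># image_mset fst K" by force
  then have "s \<in> P' - P" using assms by (simp add: K)
  moreover have "\<forall>p\<in>P' \<inter> P. (p, p) \<in># M" using assms by (auto simp: M(2))
  ultimately have "ftp_step C P P' x (\<mu> s)"
    using \<mu> M s unfolding ftp_step_def by (metis union_iff)
  then show thesis by (rule that)
qed

section \<open>The potential argument\<close>

lemma config_matching_bij:
  assumes "finite C" "finite P" "config_matching C P \<mu>"
  shows "bij_betw \<mu> C P"
  using assms
  by (intro bij_betw_of_image_mset_set)
    (auto simp: config_matching_def min_cost_matching_def perfect_matchings_def
      multiset.map_comp comp_def)

text \<open>As \<open>\<mu>\<close> is an involution mapping \<open>C\<close> onto \<open>P\<close>,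
  a \<open>t\<close> in \<open>C\<close> would put \<open>s = \<mu> t\<close> into \<open>P\<close>.
  For the second claim, \<open>s\<close> is either in \<open>C\<close>, whence \<open>t\<close> is
  in \<open>P\<close>, or outside both sets and fixed by \<open>\<mu>\<close>.\<close>

lemma ftp_step_fresh:
  assumes fin: "finite C" "finite P" and step: "ftp_step C P P' x t"
  shows "t \<notin> C" "t \<in> P \<union> P'"
proof -
  obtain \<mu> s where \<mu>: "config_matching C P \<mu>" and s: "s \<in> P' - P" and t: "t = \<mu> s"
    using step by (auto simp: ftp_step_def)
  have img: "\<mu> ` C = P"
    using config_matching_bij[OF fin \<mu>] by (simp add: bij_betw_def)
  have inv: "\<mu> t = s" using \<mu> t by (simp add: config_matching_def)
  show "t \<notin> C" using inv img s by auto
  show "t \<in> P \<union> P'"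
  proof (cases "s \<in> C")
    case True
    then show ?thesis using img t by auto
  next
    case False
    then have "t = s" using \<mu> s t by (auto simp: config_matching_def)
    then show ?thesis using s by simp
  qed
qed

text \<open>For \<open>s\<close> in \<open>C\<close>, the pair \<open>(s, \<mu> s)\<close> of the
  optimal matching is replaced by the free pairs \<open>(s, s)\<close> and
  \<open>(\<mu> s, \<mu> s)\<close>, which releases exactly its length. For \<open>s\<close> outside
  \<open>C\<close>, nothing has to be released since \<open>\<mu> s = s\<close>.\<close>

lemma config_matching_exchange:
  assumes fin: "finite C" "finite P" and \<mu>: "config_matching C P \<mu>" and "s \<notin> P"
  shows "mdist (add_mset (\<mu> s) (mset_set C)) (add_mset s (mset_set P)) + \<bar>s - \<mu> s\<bar>
    \<le> mdist (mset_set C) (mset_set P)"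
proof (cases "s \<in> C")
  case False
  then have "\<mu> s = s" using \<mu> \<open>s \<notin> P\<close> by (auto simp: config_matching_def)
  moreover have "card C = card P"
    using config_matching_bij[OF fin \<mu>] by (rule bij_betw_same_card)
  ultimately show ?thesis
    using mdist_add_le[of "mset_set C" "mset_set P" s s] by simp
next
  case True
  define C' where "C' = mset_set (C - {s})"
  define N where "N = image_mset (\<lambda>q. (q, \<mu> q)) C'"
  have C: "mset_set C = add_mset s C'"
    using True fin by (simp add: C'_def mset_set.remove)
  have opt: "min_cost_matching (mset_set C) (mset_set P) (add_mset (s, \<mu> s) N)"
    using \<mu> by (simp add: config_matching_def C N_def)
  then have P: "mset_set P = add_mset (\<mu> s) (image_mset snd N)"
    by (simp add: min_cost_matching_def perfect_matchings_def)
  have "add_mset (s, s) (add_mset (\<mu> s, \<mu> s) N)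
      \<in> perfect_matchings (add_mset (\<mu> s) (mset_set C)) (add_mset s (mset_set P))"
    by (simp add: perfect_matchings_def C P N_def multiset.map_comp comp_def add_mset_commute)
  from mdist_le[OF this] show ?thesis
    using opt by (simp add: min_cost_matching_def)
qed

text \<open>The cost \<open>\<bar>x - t\<bar>\<close> splits at \<open>s\<close>. The pair
  \<open>(s, x)\<close> of \<open>M\<close> pays for the first part and the exchange for the second,
  while the rest \<open>K\<close> of \<open>M\<close> pays for moving the prediction from
  \<open>P\<close> with \<open>s\<close> added to \<open>P'\<close>.\<close>

lemma ftp_step_potential:
  assumes fin: "finite C" "finite P" "finite P'" and step: "ftp_step C P P' x t"
  shows "\<bar>x - t\<bar> + mdist (mset_set (insert t C)) (mset_set P')
    \<le> mdist (mset_set C) (mset_set P) + mdist (mset_set P') (add_mset x (mset_set P))"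
proof -
  obtain \<mu> M s where \<mu>: "config_matching C P \<mu>"
    and M: "min_cost_matching (mset_set P') (add_mset x (mset_set P)) M"
    and s: "s \<in> P' - P" "(s, x) \<in># M" and t: "t = \<mu> s"
    using step by (auto simp: ftp_step_def)
  define Q where "Q = mset_set (P' - {s})"
  have P': "mset_set P' = add_mset s Q"
    using s fin by (simp add: Q_def mset_set.remove)
  obtain K where K: "M = add_mset (s, x) K"
    using s(2) by (auto dest!: multi_member_split)
  have KQ: "K \<in> perfect_matchings Q (mset_set P)"
    and cost: "\<bar>s - x\<bar> + matching_cost K = mdist (mset_set P') (add_mset x (mset_set P))"
    using M by (simp_all add: min_cost_matching_def P' K)
  have sQ: "size Q = card P"
    using size_eq_of_perfect_matching[OF KQ] by simp
  have sC: "card C = card P"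
    using config_matching_bij[OF fin(1,2) \<mu>] by (rule bij_betw_same_card)
  have "mdist (mset_set P) Q \<le> matching_cost K"
    using mdist_le[OF KQ] mdist_commute[of Q "mset_set P"] sQ by simp
  then have "mdist (add_mset s (mset_set P)) (mset_set P') \<le> matching_cost K"
    using mdist_add_le[of "mset_set P" Q s s] sQ by (simp add: P')
  moreover have "mdist (add_mset t (mset_set C)) (mset_set P')
      \<le> mdist (add_mset t (mset_set C)) (add_mset s (mset_set P))
        + mdist (add_mset s (mset_set P)) (mset_set P')"
    using sQ sC by (intro mdist_triangle) (simp_all add: P')
  moreover have "mdist (add_mset t (mset_set C)) (add_mset s (mset_set P)) + \<bar>s - t\<bar>
      \<le> mdist (mset_set C) (mset_set P)"
    using config_matching_exchange[OF fin(1,2) \<mu>] s t by simp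
  ultimately have "\<bar>x - t\<bar> + mdist (add_mset t (mset_set C)) (mset_set P')
      \<le> mdist (mset_set C) (mset_set P) + mdist (mset_set P') (add_mset x (mset_set P))"
    using cost by linarith
  \<comment> \<open>Freshness of \<open>t\<close> turns the inserted element into an added
    occurrence.\<close>
  then show ?thesis
    using ftp_step_fresh(1)[OF fin(1,2) step] fin by simp
qed

section \<open>Runs of several rounds\<close>

lemma config_0 [simp]: "config a 0 = {}"
  by (simp add: config_def)

lemma config_Suc: "config a (Suc i) = insert (a (Suc i)) (config a i)"
  by (simp add: config_def atLeastAtMostSuc_conv)

lemma finite_config [simp]: "finite (config a i)"
  by (simp add: config_def)

lemma ftp_run_Suc:
  "ftp_run (Suc m) r P a \<longleftrightarrow>
    ftp_run m r P a \<and> ftp_step (config a m) (P m) (P (Suc m)) (r (Suc m)) (a (Suc m))"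
  by (auto simp: ftp_run_def less_Suc_eq)

lemma config_fun_upd: "i < j \<Longrightarrow> config (a(j := t)) i = config a i"
  by (auto simp: config_def)

text \<open>The first \<open>m\<close> rounds consult \<open>a\<close> only at indices up to
  \<open>m\<close>; hence a run can be extended by one update.\<close>

lemma ftp_run_fun_upd: "m < j \<Longrightarrow> ftp_run m r P (a(j := t)) \<longleftrightarrow> ftp_run m r P a"
  by (auto simp: ftp_run_def config_fun_upd)

lemma ftp_run_config:
  assumes "finite S" "\<And>i. i \<le> m \<Longrightarrow> P i \<subseteq> S" "ftp_run m r P a"
  shows "card (config a m) = m \<and> config a m \<subseteq> S"
  using assms
proof (induction m)
  case (Suc m)
  have run: "ftp_run m r P a"
    and step: "ftp_step (config a m) (P m) (P (Suc m)) (r (Suc m)) (a (Suc m))"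
    using Suc.prems(3) by (simp_all add: ftp_run_Suc)
  have IH: "card (config a m) = m" "config a m \<subseteq> S"
    using Suc.IH[OF Suc.prems(1) _ run] Suc.prems(2) by simp_all
  have fin: "finite (P m)" using Suc.prems finite_subset by (metis le_SucI le_refl)
  have "a (Suc m) \<notin> config a m" "a (Suc m) \<in> P m \<union> P (Suc m)"
    using ftp_step_fresh[OF finite_config fin step] by auto
  moreover have "P m \<union> P (Suc m) \<subseteq> S"
    using Suc.prems by (metis Un_least le_SucI le_refl)
  ultimately show ?case
    using IH by (auto simp: config_Suc)
qed simp

lemma ftp_run_exists:
  assumes "finite S" "\<And>i. i \<le> m \<Longrightarrow> P i \<subseteq> S \<and> card (P i) = i"
  shows "\<exists>a. ftp_run m r P a"
  using assms(2)
proof (induction m)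
  case 0
  then show ?case by (simp add: ftp_run_def)
next
  case (Suc m)
  then obtain a where a: "ftp_run m r P a" by auto
  have P: "P i \<subseteq> S" "card (P i) = i" "finite (P i)" if "i \<le> Suc m" for i
    using Suc.prems[OF that] assms(1) finite_subset by auto
  have "card (config a m) = m"
    using ftp_run_config[OF assms(1) _ a] P by auto
  then obtain t where "ftp_step (config a m) (P m) (P (Suc m)) (r (Suc m)) t"
    using ftp_step_exists[of "config a m" "P m" "P (Suc m)" "r (Suc m)"] P by auto
  then have "ftp_run (Suc m) r P (a(Suc m := t))"
    using a by (simp add: ftp_run_Suc ftp_run_fun_upd config_fun_upd)
  then show ?case by blast
qed

text \<open>Telescopes the potential over the rounds.\<close>

lemma ftp_run_cost:
  assumes "\<And>i. i \<le> m \<Longrightarrow> finite (P i) \<and> card (P i) = i" "ftp_run m r P a"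
  shows "total_cost m r a + mdist (mset_set (config a m)) (mset_set (P m))
    \<le> (\<Sum>i<m. mdist (mset_set (P (Suc i))) (add_mset (r (Suc i)) (mset_set (P i))))"
  using assms
proof (induction m)
  case 0
  \<comment> \<open>Cardinality zero together with finiteness empties the initial prediction, so the
    potential starts at zero.\<close>
  then have "P 0 = {}" by auto
  then show ?case by (simp add: total_cost_def)
next
  case (Suc m)
  have fin: "finite (P m)" "finite (P (Suc m))" using Suc.prems(1) by simp_all
  have "\<bar>r (Suc m) - a (Suc m)\<bar> + mdist (mset_set (config a (Suc m))) (mset_set (P (Suc m)))
    \<le> mdist (mset_set (config a m)) (mset_set (P m))
      + mdist (mset_set (P (Suc m))) (add_mset (r (Suc m)) (mset_set (P m)))"
    unfolding config_Suc
    using ftp_step_potential[OF finite_config fin] Suc.prems(2) by (simp add: ftp_run_Suc)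
  then show ?case using Suc by (simp add: total_cost_def ftp_run_Suc)
qed

section \<open>Comparison with the offline configurations\<close>

text \<open>The detour goes from \<open>P'\<close> to the offline configuration after the round,
  \<open>C\<close> with \<open>b\<close> added; from there \<open>b\<close> moves to
  \<open>x\<close> and \<open>C\<close> to \<open>P\<close>.\<close>

lemma prediction_change_le:
  assumes fin: "finite P" "finite P'" "finite C" and "b \<notin> C"
    and card: "card P = card C" "card P' = Suc (card C)"
  shows "mdist (mset_set P') (add_mset x (mset_set P))
    \<le> mdist (mset_set P') (mset_set (insert b C)) + \<bar>x - b\<bar> + mdist (mset_set P) (mset_set C)"
proof -
  have C: "mset_set (insert b C) = add_mset b (mset_set C)"
    using assms by simp
  have "mdist (mset_set P') (add_mset x (mset_set P))
      \<le> mdist (mset_set P') (add_mset b (mset_set C))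
        + mdist (add_mset b (mset_set C)) (add_mset x (mset_set P))"
    using card by (intro mdist_triangle) auto
  also have "mdist (add_mset b (mset_set C)) (add_mset x (mset_set P))
      \<le> \<bar>b - x\<bar> + mdist (mset_set C) (mset_set P)"
    using card by (intro mdist_add_le) auto
  also have "mdist (mset_set C) (mset_set P) = mdist (mset_set P) (mset_set C)"
    using card by (intro mdist_commute) auto
  finally show ?thesis by (simp add: C abs_minus_commute)
qed

text \<open>The extra distance on the left strengthens the induction: the error after round
  \<open>m\<close> has been charged only once so far, and its second charge is held in reserve for
  the next round.\<close>

lemma prediction_changes_le:
  assumes "\<And>i. i \<le> m \<Longrightarrow> finite (P i) \<and> card (P i) = i" "inj_on b {1..m}"
  shows "(\<Sum>i<m. mdist (mset_set (P (Suc i))) (add_mset (r (Suc i)) (mset_set (P i))))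
      + mdist (mset_set (P m)) (mset_set (config b m))
    \<le> total_cost m r b + 2 * prediction_error m P b"
  using assms
proof (induction m)
  case 0
  then have "P 0 = {}" by auto
  then show ?case by (simp add: total_cost_def prediction_error_def)
next
  case (Suc m)
  have inj: "inj_on b {1..m}" and fresh: "b (Suc m) \<notin> config b m"
    using Suc.prems(2) by (auto simp: atLeastAtMostSuc_conv config_def)
  have card: "card (config b m) = m"
    using inj by (simp add: config_def card_image)
  have P: "finite (P i)" "card (P i) = i" if "i \<le> Suc m" for i
    using Suc.prems(1)[OF that] by auto
  have "mdist (mset_set (P (Suc m))) (add_mset (r (Suc m)) (mset_set (P m)))
    \<le> mdist (mset_set (P (Suc m))) (mset_set (config b (Suc m))) + \<bar>r (Suc m) - b (Suc m)\<bar>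
      + mdist (mset_set (P m)) (mset_set (config b m))"
    unfolding config_Suc using fresh card P by (intro prediction_change_le) auto
  \<comment> \<open>The reserve from the induction hypothesis absorbs the error before the round;
    the error after it is counted once here and once as the new reserve.\<close>
  then show ?case
    using Suc.IH[OF _ inj] P by (simp add: total_cost_def prediction_error_def)
qed

theorem theorem10:
  fixes S :: "real set" and n :: nat
    and r :: "nat \<Rightarrow> real" and P :: "nat \<Rightarrow> real set" and off :: "nat \<Rightarrow> real"
  assumes servers: "finite S" "card S = n"
    and predictions: "\<And>i. i \<le> n \<Longrightarrow> P i \<subseteq> S \<and> card (P i) = i"
    and offline: "valid_assignment S n off"
  shows "(\<exists>a. ftp_run n r P a) \<and>
    (\<forall>a. ftp_run n r P a \<longrightarrow>
       valid_assignment S n a \<and>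
       total_cost n r a \<le> total_cost n r off + 2 * prediction_error n P off \<and>
       (0 < total_cost n r off \<longrightarrow>
          total_cost n r a / total_cost n r off
            \<le> 1 + 2 * prediction_error n P off / total_cost n r off))"
proof (intro conjI allI impI)
  show "\<exists>a. ftp_run n r P a"
    using ftp_run_exists[OF servers(1) predictions] by simp
next
  fix a assume run: "ftp_run n r P a"
  have P: "finite (P i) \<and> card (P i) = i" if "i \<le> n" for i
    using predictions[OF that] servers(1) finite_subset by auto
  have conf: "card (config a n) = n" "config a n \<subseteq> S"
    using ftp_run_config[OF servers(1) _ run] predictions by auto
  \<comment> \<open>With \<open>n\<close> distinct servers used in \<open>n\<close> rounds, the run
    exhausts \<open>S\<close>; the same count makes \<open>a\<close> injective.\<close>
  then have "config a n = S"
    using servers card_subset_eq by metis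
  then show "valid_assignment S n a"
    using conf(1) by (auto simp: valid_assignment_def bij_betw_def config_def intro: eq_card_imp_inj_on)
  have inj: "inj_on off {1..n}"
    using offline by (simp add: valid_assignment_def bij_betw_def)
  have card_off: "card (config off n) = n"
    using inj by (simp add: config_def card_image)
  \<comment> \<open>The sum of prediction changes links the two estimates; the final potential and
    the final reserve are nonnegative and are dropped.\<close>
  show bound: "total_cost n r a \<le> total_cost n r off + 2 * prediction_error n P off"
    using ftp_run_cost[of n P r a, OF P run] prediction_changes_le[of n P off r, OF P inj]
      mdist_nonneg[of "mset_set (config a n)" "mset_set (P n)"]
      mdist_nonneg[of "mset_set (P n)" "mset_set (config off n)"] P[of n] conf(1) card_off
    by simp
  assume pos: "0 < total_cost n r off"
  have "total_cost n r a / total_cost n r off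
      \<le> (total_cost n r off + 2 * prediction_error n P off) / total_cost n r off"
    using bound pos by (intro divide_right_mono) auto
  then show "total_cost n r a / total_cost n r off
      \<le> 1 + 2 * prediction_error n P off / total_cost n r off"
    using pos by (simp add: add_divide_distrib)
qed

end
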